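(* Let $A \in \mathbb{Q}^{d\times n}$ be of rank $d$, let $b \in \mathbb{R}^n$ and $\omega \in \mathbb{R}^d$. We have $x^* \in \mathcal{L}_{A,b}^+ \cap \{x : Ax = \omega\}$ if and only if $x^*$ is the unique minimizer of the following convex optimization problem: $$\text{minimize}\quad -\frac{\pi}{2} b^t x - \sum_{j=1}^n \Big(x_j \arccos(x_j) - \sqrt{1-x_j^2}\Big)\quad \text{subject to}\quad Ax = \omega \ \text{ and }\ x \in (-1,1)^n.$$ In particular, a minimizer exists if and only if $\omega \in \Omega_{A,b}^+$, and in that case it is unique.
   Context: For $A\in\mathbb{Q}^{d\times n}$ and $b\in\mathbb{R}^n$, let $\operatorname{Row}(A)\subseteq\mathbb{C}^n$ be the $\mathbb{C}$-span of the rows of $A$ and $L_{A,b} = \operatorname{Row}(A) - \frac{\pi}{2}b$. Let $\cos$ be the coordinate-wise cosine and $\arccos:(-1,1)\to(0,\pi)$ the usual inverse. Define $$\mathcal{L}_{A,b}^+ = \cos\big(L_{A,b}\cap(0,\pi)^n\big) \subset (-1,1)^n,\qquad \Omega_{A,b}^+ = \{Ax \in \mathbb{R}^d : x \in \mathcal{L}_{A,b}^+\},$$ where $(0,\pi)^n\subset\mathbb{R}^n$ is a product of real open intervals. *)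

theory Defs
  imports "HOL-Analysis.Analysis"
begin

text \<open>
  A rational \<open>d \<times> n\<close> matrix has type \<open>rat ^ 'n ^ 'd\<close>; it is read over another field of
  characteristic 0 by coercing its entries.
\<close>

abbreviation of_rat_matrix :: "rat ^ 'n ^ 'd \<Rightarrow> ('a::field_char_0) ^ 'n ^ 'd" where
  "of_rat_matrix \<equiv> map_matrix of_rat"

definition Row :: "rat ^ 'n ^ 'd \<Rightarrow> (complex ^ 'n) set" where
  "Row A = vec.span (rows (of_rat_matrix A :: complex ^ 'n ^ 'd))"

definition complex_vec :: "real ^ 'n \<Rightarrow> complex ^ 'n" where
  "complex_vec v = (\<chi> j. complex_of_real (v $ j))"

definition L :: "rat ^ 'n ^ 'd \<Rightarrow> real ^ 'n \<Rightarrow> (complex ^ 'n) set" where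
  "L A b = (\<lambda>v. v - complex_vec ((pi / 2) *\<^sub>R b)) ` Row A"

text \<open>
  The intersection \<open>L A b \<inter> (0,\<pi>)\<^sup>n\<close> is taken inside \<open>\<complex>\<^sup>n\<close>; it is represented by its
  preimage under the embedding \<^const>\<open>complex_vec\<close> of \<open>\<real>\<^sup>n\<close>, so that its cosines are real vectors.
\<close>

definition L_plus :: "rat ^ 'n ^ 'd \<Rightarrow> real ^ 'n \<Rightarrow> (real ^ 'n) set" where
  "L_plus A b = (\<lambda>\<theta>. \<chi> j. cos (\<theta> $ j)) ` {\<theta> \<in> box (vec 0) (vec pi). complex_vec \<theta> \<in> L A b}"

definition Omega_plus :: "rat ^ 'n ^ 'd \<Rightarrow> real ^ 'n \<Rightarrow> (real ^ 'd) set" where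
  "Omega_plus A b = {of_rat_matrix A *v x | x. x \<in> L_plus A b}"

definition objective :: "real ^ 'n \<Rightarrow> real ^ 'n \<Rightarrow> real" where
  "objective b x =
     - (pi / 2) * (b \<bullet> x) - (\<Sum>j\<in>UNIV. x $ j * arccos (x $ j) - sqrt (1 - (x $ j)\<^sup>2))"

definition feasible :: "rat ^ 'n ^ 'd \<Rightarrow> real ^ 'd \<Rightarrow> (real ^ 'n) set" where
  "feasible A \<omega> = {x. of_rat_matrix A *v x = \<omega> \<and> x \<in> box (vec (-1)) (vec 1)}"

definition minimizer :: "rat ^ 'n ^ 'd \<Rightarrow> real ^ 'n \<Rightarrow> real ^ 'd \<Rightarrow> real ^ 'n \<Rightarrow> bool" where
  "minimizer A b \<omega> x \<longleftrightarrow> is_arg_min (objective b) (\<lambda>y. y \<in> feasible A \<omega>) x"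

definition unique_minimizer :: "rat ^ 'n ^ 'd \<Rightarrow> real ^ 'n \<Rightarrow> real ^ 'd \<Rightarrow> real ^ 'n \<Rightarrow> bool" where
  "unique_minimizer A b \<omega> x \<longleftrightarrow> minimizer A b \<omega> x \<and> (\<forall>y. minimizer A b \<omega> y \<longrightarrow> y = x)"

end

theory Submission
  imports Defs
begin

text \<open>
  Since \<open>t arccos t - \<surd>(1 - t\<^sup>2)\<close> has the strictly decreasing derivative \<open>arccos t\<close>, the objective
  is strictly convex on the cube with gradient \<open>- (\<pi>/2 b + arccos x)\<close>. Hence a feasible point is a
  minimizer iff its gradient is orthogonal to \<open>ker A\<close>, that is, iff
  \<open>arccos x + \<pi>/2 b\<close> lies in the row space of \<open>A\<close>, and it is then the only one.
\<close>

section \<open>Tangent inequality and convexity of the objective\<close>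

definition arccos_vec :: "real ^ 'n \<Rightarrow> real ^ 'n" where
  "arccos_vec x = (\<chi> j. arccos (x $ j))"

lemma mem_box_vec: "x \<in> box (vec l) (vec u) \<longleftrightarrow> (\<forall>j. l < x $ j \<and> x $ j < u)"
  for x :: "real ^ 'n"
  by (simp add: mem_box_cart)

text \<open>These simp rules would hide the corners of a box from \<open>mem_box_vec\<close>.\<close>

declare vec_0 [simp del] vec_1 [simp del]

text \<open>Differentiating \<open>arccos\<close> contributes - t / sqrt (1 - t^2) and the root
  contributes the opposite term, so only \<open>arccos t\<close> survives.\<close>

lemma has_real_derivative_arccos_primitive:
  assumes "- 1 < t" "t < 1"
  shows "((\<lambda>t. t * arccos t - sqrt (1 - t\<^sup>2)) has_real_derivative arccos t) (at t)"
proof -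
  have "1 - t\<^sup>2 > 0"
    using assms by (simp add: abs_square_less_1)
  then show ?thesis
    using assms
    by (auto intro!: derivative_eq_intros simp: field_simps)
qed

text \<open>Strict concavity in tangent form. By the mean value theorem the chord has slope
  \<open>arccos z\<close> with z strictly between x and y; as \<open>arccos\<close> strictly
  decreases, comparison with \<open>arccos x\<close> gives the same inequality on either side of
  x.\<close>

lemma arccos_primitive_less_tangent:
  assumes "x \<in> {-1<..<1}" "y \<in> {-1<..<1}" "x \<noteq> y"
  shows "y * arccos y - sqrt (1 - y\<^sup>2) < x * arccos x - sqrt (1 - x\<^sup>2) + arccos x * (y - x)"
proof -
  let ?f = "\<lambda>t. t * arccos t - sqrt (1 - t\<^sup>2)"
  consider "x < y" | "y < x" using assms(3) by linarith
  then show ?thesis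
  proof cases
    case 1
    then obtain z where z: "x < z" "z < y" "?f y - ?f x = (y - x) * arccos z"
      using MVT2[of x y ?f arccos] has_real_derivative_arccos_primitive assms by force
    then have "(y - x) * arccos z < (y - x) * arccos x"
      using assms by (intro mult_strict_left_mono arccos_less_arccos) auto
    with z show ?thesis by (simp add: algebra_simps)
  next
    case 2
    then obtain z where z: "y < z" "z < x" "?f x - ?f y = (x - y) * arccos z"
      using MVT2[of y x ?f arccos] has_real_derivative_arccos_primitive assms by force
    then have "(x - y) * arccos x < (x - y) * arccos z"
      using assms by (intro mult_strict_left_mono arccos_less_arccos) auto
    with z show ?thesis by (simp add: algebra_simps)
  qed
qed

text \<open>The scalar inequalities add up, with strictness from one coordinate where x and y
  differ; the term in b is linear and so equals its own tangent. Both convexity and uniqueness of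
  minimizers rest on this bound.\<close>

lemma objective_greater_tangent:
  assumes "x \<in> box (vec (-1)) (vec 1)" "y \<in> box (vec (-1)) (vec 1)" "x \<noteq> y"
  shows "objective b y > objective b x - (arccos_vec x + (pi / 2) *\<^sub>R b) \<bullet> (y - x)"
proof -
  let ?f = "\<lambda>t. t * arccos t - sqrt (1 - t\<^sup>2)"
  obtain i where i: "x $ i \<noteq> y $ i"
    using assms(3) by (auto simp: vec_eq_iff)
  have "(\<Sum>j\<in>UNIV. ?f (y $ j)) < (\<Sum>j\<in>UNIV. ?f (x $ j) + arccos (x $ j) * (y $ j - x $ j))"
  proof (rule sum_strict_mono_ex1)
    show "\<forall>j\<in>UNIV. ?f (y $ j) \<le> ?f (x $ j) + arccos (x $ j) * (y $ j - x $ j)"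
    proof
      fix j
      show "?f (y $ j) \<le> ?f (x $ j) + arccos (x $ j) * (y $ j - x $ j)"
        using arccos_primitive_less_tangent[of "x $ j" "y $ j"] assms(1,2)
        by (cases "x $ j = y $ j") (simp_all add: mem_box_vec)
    qed
    show "\<exists>j\<in>UNIV. ?f (y $ j) < ?f (x $ j) + arccos (x $ j) * (y $ j - x $ j)"
      using arccos_primitive_less_tangent[OF _ _ i] assms(1,2) by (auto simp: mem_box_vec)
  qed simp
  also have "\<dots> = (\<Sum>j\<in>UNIV. ?f (x $ j)) + arccos_vec x \<bullet> (y - x)"
    by (simp add: sum.distrib inner_vec_def arccos_vec_def)
  finally show ?thesis
    unfolding objective_def by (simp add: inner_simps algebra_simps)
qed

lemma convex_on_objective:
  fixes b :: "real ^ 'n"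
  shows "convex_on (box (vec (-1)) (vec 1)) (objective b)"
proof (rule convex_onI)
  let ?g = "\<lambda>x. arccos_vec x + (pi / 2) *\<^sub>R b"
  fix t :: real and x y :: "real ^ 'n"
  assume t: "0 < t" "t < 1" and xy: "x \<in> box (vec (-1)) (vec 1)" "y \<in> box (vec (-1)) (vec 1)"
  define z where "z = (1 - t) *\<^sub>R x + t *\<^sub>R y"
  have z: "z \<in> box (vec (-1)) (vec 1)"
    using convexD[OF convex_box(2) xy, of "1 - t" t] t by (simp add: z_def)
  have tangent: "objective b w \<ge> objective b z - ?g z \<bullet> (w - z)" if "w \<in> box (vec (-1)) (vec 1)" for w
    using objective_greater_tangent[OF z that, of b] by (cases "z = w") auto
  \<comment> \<open>The tangent at the intermediate point z supports the objective at both
    endpoints; z being their weighted mean, the linear terms cancel in the weighted sum.\<close>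
  have "(1 - t) * (objective b z - ?g z \<bullet> (x - z)) + t * (objective b z - ?g z \<bullet> (y - z))
      \<le> (1 - t) * objective b x + t * objective b y"
    using t xy by (intro add_mono mult_left_mono tangent) auto
  moreover have "(1 - t) * (?g z \<bullet> (x - z)) + t * (?g z \<bullet> (y - z)) = 0"
  proof -
    have "(1 - t) *\<^sub>R (x - z) + t *\<^sub>R (y - z) = 0"
      by (simp add: z_def algebra_simps)
    then show ?thesis
      by (metis inner_add_right inner_scaleR_right inner_zero_right)
  qed
  ultimately show "objective b ((1 - t) *\<^sub>R x + t *\<^sub>R y) \<le> (1 - t) * objective b x + t * objective b y"
    by (fold z_def) (simp add: algebra_simps)
qed (rule convex_box)

lemma convex_feasible: "convex (feasible A \<omega>)"
proof -
  have "feasible A \<omega> = ((*v) (of_rat_matrix A) -` {\<omega>}) \<inter> box (vec (-1)) (vec 1)"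
    by (auto simp: feasible_def)
  then show ?thesis
    by (simp add: convex_Int convex_linear_vimage convex_box)
qed

section \<open>First-order condition along kernel directions\<close>

lemma has_real_derivative_objective_line:
  assumes "x \<in> box (vec (-1)) (vec 1)"
  shows "((\<lambda>t. objective b (x + t *\<^sub>R v)) has_real_derivative
    - ((arccos_vec x + (pi / 2) *\<^sub>R b) \<bullet> v)) (at 0)"
proof -
  let ?f = "\<lambda>t. t * arccos t - sqrt (1 - t\<^sup>2)"
  have "((\<lambda>t. ?f (x $ j + t * v $ j)) has_real_derivative arccos (x $ j) * v $ j) (at 0)" for j
  proof (rule DERIV_chain2[where f = ?f])
    show "(?f has_real_derivative arccos (x $ j)) (at (x $ j + 0 * v $ j))"
      using assms has_real_derivative_arccos_primitive[of "x $ j"] by (simp add: mem_box_vec)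
    show "((\<lambda>t. x $ j + t * v $ j) has_real_derivative v $ j) (at 0)"
      by (auto intro!: derivative_eq_intros)
  qed
  then have "((\<lambda>t. \<Sum>j\<in>UNIV. ?f (x $ j + t * v $ j)) has_real_derivative
      (\<Sum>j\<in>UNIV. arccos (x $ j) * v $ j)) (at 0)"
    by (intro DERIV_sum)
  moreover have "((\<lambda>t. - (pi / 2) * (b \<bullet> x + t * (b \<bullet> v))) has_real_derivative
      - (pi / 2) * (b \<bullet> v)) (at 0)"
    by (auto intro!: derivative_eq_intros)
  ultimately have "((\<lambda>t. - (pi / 2) * (b \<bullet> x + t * (b \<bullet> v)) - (\<Sum>j\<in>UNIV. ?f (x $ j + t * v $ j)))
      has_real_derivative - (pi / 2) * (b \<bullet> v) - (\<Sum>j\<in>UNIV. arccos (x $ j) * v $ j)) (at 0)"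
    by (rule DERIV_diff[rotated])
  moreover have "arccos_vec x \<bullet> v = (\<Sum>j\<in>UNIV. arccos (x $ j) * v $ j)"
    by (simp add: inner_vec_def arccos_vec_def)
  ultimately show ?thesis
    by (simp add: objective_def inner_simps algebra_simps)
qed

text \<open>Moving along a kernel direction preserves the linear constraint, and the cube is open,
  so x can move both ways. Fermat's criterion then makes the directional derivative vanish.\<close>

lemma minimizer_gradient_orthogonal:
  assumes min: "minimizer A b \<omega> x" and v: "of_rat_matrix A *v v = (0 :: real ^ 'd)"
  shows "(arccos_vec x + (pi / 2) *\<^sub>R b) \<bullet> v = 0"
proof -
  have x: "x \<in> box (vec (-1)) (vec 1)" "of_rat_matrix A *v x = \<omega>"
    and le: "\<And>y. y \<in> feasible A \<omega> \<Longrightarrow> objective b x \<le> objective b y"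
    using min by (auto simp: minimizer_def is_arg_min_linorder feasible_def)
  have "open ((\<lambda>t. x + t *\<^sub>R v) -` box (vec (-1)) (vec 1))"
    by (intro open_vimage open_box continuous_intros)
  then obtain d where d: "d > 0" "\<And>t. \<bar>t\<bar> < d \<Longrightarrow> x + t *\<^sub>R v \<in> box (vec (-1)) (vec 1)"
    using x(1) by (auto simp: open_dist dist_real_def dest!: bspec[of _ _ 0])
  have "of_rat_matrix A *v (x + t *\<^sub>R v) = \<omega>" for t
    using x v by (simp add: matrix_vector_right_distrib matrix_vector_mult_scaleR)
  then have "\<forall>t. \<bar>0 - t\<bar> < d \<longrightarrow> objective b (x + 0 *\<^sub>R v) \<le> objective b (x + t *\<^sub>R v)"
    using d by (auto intro!: le simp: feasible_def)
  then show ?thesis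
    using DERIV_local_min[OF has_real_derivative_objective_line[OF x(1)] d(1)] by simp
qed

section \<open>Row space and membership in \<open>L_plus\<close>\<close>

lemma of_real_of_rat: "(of_real (of_rat q) :: 'a::real_field) = of_rat q"
  by (cases q) (simp add: of_rat_rat of_real_divide)

text \<open>
  The complex vectors \<open>u\<close> whose bilinear (not Hermitian) pairing with a real \<open>v\<close>
  vanishes form a complex subspace, so the complex row span imposes no more on \<open>w\<close> than the real one.
\<close>

lemma complex_vec_in_Row_iff:
  fixes A :: "rat ^ 'n ^ 'd"
  shows "complex_vec w \<in> Row A \<longleftrightarrow> (\<forall>v. of_rat_matrix A *v v = (0 :: real ^ 'd) \<longrightarrow> w \<bullet> v = 0)"
proof (intro iffI allI impI)
  fix v :: "real ^ 'n"
  assume w: "complex_vec w \<in> Row A" and v: "of_rat_matrix A *v v = (0 :: real ^ 'd)"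
  let ?S = "{u :: complex ^ 'n. (\<Sum>j\<in>UNIV. u $ j * of_real (v $ j)) = 0}"
  have "vec.subspace ?S"
    by (auto simp: vec.subspace_def distrib_right sum.distrib mult.assoc simp flip: sum_distrib_left)
  moreover have "rows (of_rat_matrix A :: complex ^ 'n ^ 'd) \<subseteq> ?S"
  proof -
    have "(\<Sum>j\<in>UNIV. of_rat (A $ i $ j) * complex_of_real (v $ j)) = 0" for i
    proof -
      have "(\<Sum>j\<in>UNIV. of_rat (A $ i $ j) * v $ j) = 0"
        using v by (simp add: vec_eq_iff matrix_vector_mult_def map_matrix_def)
      then have "complex_of_real (\<Sum>j\<in>UNIV. of_rat (A $ i $ j) * v $ j) = 0"
        by simp
      then show ?thesis
        by (simp add: of_real_of_rat)
    qed
    then show ?thesis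
      by (auto simp: rows_def row_def map_matrix_def)
  qed
  ultimately have "complex_vec w \<in> ?S"
    using w vec.span_minimal unfolding Row_def by blast
  then have "complex_of_real (\<Sum>j\<in>UNIV. w $ j * v $ j) = 0"
    by (simp add: complex_vec_def)
  then show "w \<bullet> v = 0"
    by (simp only: of_real_eq_0_iff inner_vec_def inner_real_def)
next
  let ?R = "of_rat_matrix A :: real ^ 'n ^ 'd"
  assume orth: "\<forall>v. ?R *v v = 0 \<longrightarrow> w \<bullet> v = 0"
  \<comment> \<open>The component z of w orthogonal to the real row space lies in the kernel, so it
    is orthogonal to w as well as to y. Hence z is orthogonal to itself and vanishes.\<close>
  obtain y z where yz: "y \<in> span (rows ?R)" "\<And>u. u \<in> span (rows ?R) \<Longrightarrow> orthogonal z u" "w = y + z"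
    using orthogonal_subspace_decomp_exists[of "rows ?R" w] by metis
  have "row i ?R \<bullet> z = 0" for i
    using yz(2)[of "row i ?R"] by (auto simp: rows_def orthogonal_def inner_commute intro: span_base)
  then have "?R *v z = 0"
    unfolding row_def vec_lambda_eta by (simp add: vec_eq_iff matrix_vector_mul_component)
  then have "w \<bullet> z = 0" and "z \<bullet> y = 0"
    using orth yz by (auto simp: orthogonal_def)
  then have "w \<in> span (rows ?R)"
    using yz by (simp add: inner_simps inner_commute)
  then show "complex_vec w \<in> Row A"
  proof (induction rule: span_induct)
    \<comment> \<open>The preimage of \<open>Row A\<close> under \<open>complex_vec\<close> is a
      real subspace; it remains to see that it contains the real rows.\<close>
    case base
    have "complex_vec (0 :: real ^ 'n) = 0"
      "complex_vec (u + v) = complex_vec u + complex_vec v"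
      "complex_vec (c *\<^sub>R u) = complex_of_real c *s complex_vec u" for u v :: "real ^ 'n" and c
      by (simp_all add: complex_vec_def vec_eq_iff)
    then show ?case
      by (auto simp: subspace_def Row_def vec.span_zero vec.span_add vec.span_scale)
  next
    case (step u)
    then obtain i where "u = row i ?R"
      by (auto simp: rows_def)
    then have "complex_vec u = row i (of_rat_matrix A)"
      by (simp add: complex_vec_def row_def map_matrix_def vec_eq_iff of_real_of_rat)
    then show ?case
      by (auto simp: Row_def rows_def intro: vec.span_base)
  qed
qed

text \<open>Since \<open>arccos\<close> inverts cosine between (0,pi) and (-1,1), the angle vector
  can be eliminated. Undoing the shift by (pi/2) b leaves a row-space condition on minus the
  gradient of the objective at x.\<close>

lemma L_plus_iff:
  "x \<in> L_plus A b \<longleftrightarrow>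
    x \<in> box (vec (-1)) (vec 1) \<and> complex_vec (arccos_vec x + (pi / 2) *\<^sub>R b) \<in> Row A"
proof -
  have L: "complex_vec \<theta> \<in> L A b \<longleftrightarrow> complex_vec (\<theta> + (pi / 2) *\<^sub>R b) \<in> Row A" for \<theta>
  proof -
    have "complex_vec (\<theta> + (pi / 2) *\<^sub>R b) = complex_vec \<theta> + complex_vec ((pi / 2) *\<^sub>R b)"
      by (simp add: complex_vec_def vec_eq_iff)
    then show ?thesis
      by (force simp: L_def algebra_simps)
  qed
  show ?thesis
  proof
    assume "x \<in> L_plus A b"
    then obtain \<theta> where \<theta>: "\<theta> \<in> box (vec 0) (vec pi)" "complex_vec \<theta> \<in> L A b"
      "x = (\<chi> j. cos (\<theta> $ j))"
      by (auto simp: L_plus_def)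
    have "- 1 < cos (\<theta> $ j) \<and> cos (\<theta> $ j) < 1" for j
      using cos_monotone_0_pi[of 0 "\<theta> $ j"] cos_monotone_0_pi[of "\<theta> $ j" pi] \<theta>(1)
      by (simp add: mem_box_vec less_imp_le)
    moreover have "arccos_vec x = \<theta>"
      using \<theta> by (simp add: arccos_vec_def vec_eq_iff mem_box_vec arccos_cos less_imp_le)
    ultimately show "x \<in> box (vec (-1)) (vec 1) \<and> complex_vec (arccos_vec x + (pi / 2) *\<^sub>R b) \<in> Row A"
      using \<theta> L by (auto simp: mem_box_vec)
  next
    assume x: "x \<in> box (vec (-1)) (vec 1) \<and> complex_vec (arccos_vec x + (pi / 2) *\<^sub>R b) \<in> Row A"
    then have "arccos_vec x \<in> box (vec 0) (vec pi)"
      by (auto simp: arccos_vec_def mem_box_vec arccos_lt_bounded)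
    moreover have "x = (\<chi> j. cos (arccos_vec x $ j))"
      using x by (simp add: arccos_vec_def vec_eq_iff mem_box_vec less_imp_le)
    ultimately show "x \<in> L_plus A b"
      using x L unfolding L_plus_def by blast
  qed
qed

section \<open>Minimizers are the points of \<open>L_plus\<close> in the fibre\<close>

lemma minimizer_imp_L_plus:
  assumes "minimizer A b \<omega> x"
  shows "x \<in> L_plus A b" "of_rat_matrix A *v x = \<omega>"
  using assms minimizer_gradient_orthogonal[OF assms]
  by (auto simp: L_plus_iff complex_vec_in_Row_iff minimizer_def is_arg_min_def feasible_def)

text \<open>The difference of two feasible points lies in the kernel, so the linear term of the
  tangent bound vanishes and its strictness carries over.\<close>

lemma L_plus_strict_minimum:
  assumes "x \<in> L_plus A b" "of_rat_matrix A *v x = \<omega>" "y \<in> feasible A \<omega>" "y \<noteq> x"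
  shows "objective b x < objective b y"
proof -
  have "of_rat_matrix A *v (y - x) = 0"
    using assms by (simp add: feasible_def matrix_vector_mult_diff_distrib)
  then have "(arccos_vec x + (pi / 2) *\<^sub>R b) \<bullet> (y - x) = 0"
    using assms(1) unfolding L_plus_iff complex_vec_in_Row_iff by blast
  then show ?thesis
    using objective_greater_tangent[of x y b] assms by (auto simp: L_plus_iff feasible_def)
qed

lemma L_plus_imp_unique_minimizer:
  assumes "x \<in> L_plus A b" "of_rat_matrix A *v x = \<omega>"
  shows "unique_minimizer A b \<omega> x"
proof -
  have "x \<in> feasible A \<omega>"
    using assms by (simp add: L_plus_iff feasible_def)
  then show ?thesis
    using L_plus_strict_minimum[OF assms]
    unfolding unique_minimizer_def minimizer_def is_arg_min_def by (metis less_asym)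
qed

theorem theorem5p1:
  fixes A :: "rat ^ 'n ^ 'd" and b :: "real ^ 'n" and \<omega> :: "real ^ 'd"
  assumes "rank A = CARD('d)"
  shows "convex_on (box (vec (-1)) (vec 1)) (objective b) \<and> convex (feasible A \<omega>)
    \<and> (\<forall>x. x \<in> L_plus A b \<inter> {x. of_rat_matrix A *v x = \<omega>} \<longleftrightarrow> unique_minimizer A b \<omega> x)
    \<and> ((\<exists>x. minimizer A b \<omega> x) \<longleftrightarrow> \<omega> \<in> Omega_plus A b)
    \<and> (\<omega> \<in> Omega_plus A b \<longrightarrow> (\<exists>!x. minimizer A b \<omega> x))"
proof -
  have iff: "x \<in> L_plus A b \<and> of_rat_matrix A *v x = \<omega> \<longleftrightarrow> minimizer A b \<omega> x" for x
    using minimizer_imp_L_plus L_plus_imp_unique_minimizer unfolding unique_minimizer_def by blast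
  \<comment> \<open>Every minimizer lies in \<open>L_plus\<close>, where minimality is strict, so
    being a minimizer already entails uniqueness.\<close>
  moreover have "minimizer A b \<omega> x \<longleftrightarrow> unique_minimizer A b \<omega> x" for x
    using iff L_plus_imp_unique_minimizer unfolding unique_minimizer_def by blast
  moreover have "\<omega> \<in> Omega_plus A b \<longleftrightarrow> (\<exists>x. minimizer A b \<omega> x)"
    unfolding Omega_plus_def iff[symmetric] by blast
  ultimately show ?thesis
    using convex_on_objective convex_feasible unfolding unique_minimizer_def by blast
qed

end
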